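(* Let $\omega$ and $\sigma$ be two production rules whose associated rule operators $L$ and $M$ on $xK[x]$ commute, i.e. $LM=ML$, and let $b\ge 1$ be an integer. Let $\mu_r^{(s)}(x)=\sum_i \mu_{r,i}^{(s)}x^i$ be the $r$-th level polynomial of the generating tree of $\sigma$ with axiom $(s)$, let $(l_n^{(a)})_{n\ge 0}$ be the numerical sequence associated with $\omega$ with axiom $(a)$, and let $(f_n^{(b)})_{n\ge 0}$ be the numerical sequence determined by the doubled mixed succession rule $(b)\omega^{+1}\sigma^{+2}$. Then for every $n\ge 0$ $$f_n^{(b)}=\sum_{k\ge 0}\binom{n-k}{k}\sum_i \mu_{k,i}^{(b)}\, l_{n-2k}^{(i)} .$$
   Context: $K$ is a field; one may take $K=\mathbf{R}$. A production rule $\omega$ assigns to each label $k\ge 1$ a finite multiset of positive integer labels $(e_1(k)),(e_2(k)),\dots$ (the number of labels produced by $(k)$ need not equal $k$). Its rule operator is the linear operator $L$ on $xK[x]$ (the span of the positive powers of $x$) with $L(x^k)=\sum_j x^{e_j(k)}$ for $k\ge 1$. The generating tree of $\omega$ with axiom $(a)$ is the rooted labelled tree whose root (level $0$) has label $(a)$ and in which each node labelled $(k)$ at level $n$ has sons labelled $(e_1(k)),(e_2(k)),\dots$ at level $n+1$. The $n$-th level polynomial of a generating tree is $\sum_i p_{n,i}x^i$, where $p_{n,i}$ is the number of nodes labelled $i$ at level $n$; the associated numerical sequence is the total number of nodes at level $n$, i.e. the level polynomial evaluated at $x=1$. The doubled mixed succession rule $(b)\omega^{+1}\sigma^{+2}$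 has the generating tree with root labelled $(b)$ at level $0$ in which each node labelled $(k)$ at level $n$ produces one set of sons at level $n+1$, with labels given by $\omega$ applied to $k$, and another set of sons at level $n+2$, with labels given by $\sigma$ applied to $k$. Its sequence counts the nodes at level $n$. Convention: the terms of the sum over $k$ with $2k>n$ are zero.
   Formalization: The field K is assumed to have characteristic 0 (e.g. K = R); in characteristic p the claim fails, e.g. for p = 2 with ω(1) = {1,1}, ω(k) empty for k > 1, σ(k) = {k+1}, b = 1, n = 3, where the two sides are 10 and 8. *)

theory Defs
  imports "HOL-Library.Multiset" "HOL-Computational_Algebra.Polynomial"
begin

text \<open>Labels are positive integers, represented as nonzero elements of \<^typ>\<open>nat\<close>.
  The value of a rule at \<open>0\<close> is irrelevant.\<close>

type_synonym rule = "nat \<Rightarrow> nat multiset"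

definition production_rule :: "rule \<Rightarrow> bool" where
  "production_rule \<omega> \<longleftrightarrow> (\<forall>k\<ge>1. \<forall>e\<in>#\<omega> k. e \<ge> 1)"

definition xpolys :: "'k::field poly set"  \<comment> \<open>the space \<open>xK[x]\<close>\<close> where
  "xpolys = {p. coeff p 0 = 0}"

text \<open>The linear extension of \<open>x\<^sup>k \<mapsto> \<Sum>\<^sub>j x\<^bsup>e\<^sub>j(k)\<^esup>\<close>, written as a total function on
  \<open>K[x]\<close>; only its restriction to \<^const>\<open>xpolys\<close> is meaningful.\<close>

definition rule_op :: "rule \<Rightarrow> 'k::field poly \<Rightarrow> 'k poly" where
  "rule_op \<omega> p = (\<Sum>k\<le>degree p. smult (coeff p k) (\<Sum>e\<in>#\<omega> k. monom 1 e))"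

lemma rule_op_bound:
  assumes "degree p \<le> n"
  shows "rule_op \<omega> p = (\<Sum>k\<le>n. smult (coeff p k) (\<Sum>e\<in>#\<omega> k. monom 1 e))"
  unfolding rule_op_def using assms
  by (intro sum.mono_neutral_left) (auto simp: coeff_eq_0)

lemma rule_op_monom: "rule_op \<omega> (monom 1 k) = (\<Sum>e\<in>#\<omega> k. monom 1 e)"
proof -
  have "rule_op \<omega> (monom 1 k) =
      (\<Sum>i\<le>k. smult (coeff (monom 1 k) i) (\<Sum>e\<in>#\<omega> i. monom 1 e))"
    by (intro rule_op_bound degree_monom_le)
  also have "\<dots> = (\<Sum>i\<le>k. if i = k then (\<Sum>e\<in>#\<omega> i. monom 1 e) else 0)"
    by (intro sum.cong) auto
  finally show ?thesis by simp
qed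

lemma rule_op_add: "rule_op \<omega> (p + q) = rule_op \<omega> p + rule_op \<omega> q"
proof -
  let ?n = "max (degree p) (degree q)"
  have "degree (p + q) \<le> ?n" by (rule degree_add_le_max)
  then show ?thesis
    by (simp add: rule_op_bound[of _ ?n] smult_add_left sum.distrib)
qed

lemma rule_op_smult: "rule_op \<omega> (smult c p) = smult c (rule_op \<omega> p)"
proof -
  have "smult c (\<Sum>k\<in>A. f k) = (\<Sum>k\<in>A. smult c (f k))" for A :: "nat set" and f
    by (induction A rule: infinite_finite_induct) (auto simp: smult_add_right)
  then show ?thesis
    by (subst rule_op_bound[of "smult c p" "degree p"])
      (simp_all add: degree_smult_le rule_op_def del: degree_smult_eq)
qed

lemma rule_op_xpolys:
  assumes "production_rule \<omega>" "p \<in> xpolys"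
  shows "rule_op \<omega> p \<in> xpolys"
proof -
  have "coeff (\<Sum>e\<in>#A. monom (1::'a) e) 0 = 0" if "\<forall>e\<in>#A. e \<ge> 1" for A :: "nat multiset"
    using that by (induction A) auto
  then have "coeff p k * coeff (\<Sum>e\<in>#\<omega> k. monom 1 e) 0 = 0" for k
    using assms by (cases k) (auto simp: production_rule_def xpolys_def)
  then show ?thesis
    unfolding rule_op_def xpolys_def coeff_sum coeff_smult mem_Collect_eq
    by (intro sum.neutral) blast
qed

codatatype gtree = Node (label: nat) (sons: "gtree multiset")

primcorec generating_tree :: "rule \<Rightarrow> nat \<Rightarrow> gtree" where
  "label (generating_tree \<omega> a) = a"
| "sons (generating_tree \<omega> a) = image_mset (generating_tree \<omega>) (\<omega> a)"

text \<open>The labels of the nodes at level \<open>n\<close>, one occurrence for each node.\<close>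

primrec level :: "nat \<Rightarrow> gtree \<Rightarrow> nat multiset" where
  "level 0 t = {#label t#}"
| "level (Suc n) t = (\<Sum>s\<in>#sons t. level n s)"

definition level_poly :: "gtree \<Rightarrow> nat \<Rightarrow> nat poly" where
  "level_poly t n = (\<Sum>i\<in>set_mset (level n t). monom (count (level n t) i) i)"

definition level_size :: "gtree \<Rightarrow> nat \<Rightarrow> nat" where
  "level_size t n = size (level n t)"

lemma coeff_level_poly: "coeff (level_poly t n) i = count (level n t) i"
  by (simp add: level_poly_def coeff_sum sum.delta not_in_iff)

lemma level_size_eq_poly: "level_size t n = poly (level_poly t n) 1"
  by (simp add: level_size_def level_poly_def poly_sum poly_monom size_multiset_overloaded_eq)

text \<open>In the tree of a doubled mixed rule, a node has two separate collections of sons: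
  those one level below it and those two levels below it.\<close>

codatatype mtree = MNode (mlabel: nat) (sons1: "mtree multiset") (sons2: "mtree multiset")

primcorec doubled_mixed_tree :: "rule \<Rightarrow> rule \<Rightarrow> nat \<Rightarrow> mtree" where
  "mlabel (doubled_mixed_tree \<omega> \<sigma> b) = b"
| "sons1 (doubled_mixed_tree \<omega> \<sigma> b) = image_mset (doubled_mixed_tree \<omega> \<sigma>) (\<omega> b)"
| "sons2 (doubled_mixed_tree \<omega> \<sigma> b) = image_mset (doubled_mixed_tree \<omega> \<sigma>) (\<sigma> b)"

fun mlevel :: "nat \<Rightarrow> mtree \<Rightarrow> nat multiset" where
  "mlevel 0 t = {#mlabel t#}"
| "mlevel (Suc 0) t = (\<Sum>s\<in>#sons1 t. mlevel 0 s)"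
| "mlevel (Suc (Suc n)) t = (\<Sum>s\<in>#sons1 t. mlevel (Suc n) s) + (\<Sum>s\<in>#sons2 t. mlevel n s)"

definition mlevel_size :: "mtree \<Rightarrow> nat \<Rightarrow> nat" where
  "mlevel_size t n = size (mlevel n t)"

end

theory Submission
  imports Defs
begin

text \<open>Extended additively to multisets of labels, the two rules become commuting endomorphisms
  \<open>S\<close> (for \<open>\<omega>\<close>) and \<open>T\<close> (for \<open>\<sigma>\<close>); a multiset is recovered from its polynomial because the field
  has characteristic zero. The levels of the mixed tree obey \<open>F\<^sub>n\<^sub>+\<^sub>2 = F\<^sub>n\<^sub>+\<^sub>1 S + F\<^sub>n T\<close>, so
  commutation gives \<open>F\<^sub>n = \<Sum>\<^sub>k C(n - k, k) S\<^bsup>n - 2k\<^esup> T\<^bsup>k\<^esup>\<close> by Pascal's rule.\<close>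

definition step :: "rule \<Rightarrow> nat multiset \<Rightarrow> nat multiset" where
  "step \<omega> A = (\<Sum>a\<in>#A. \<omega> a)"

lemma step_empty [simp]: "step \<omega> {#} = {#}"
  and step_single [simp]: "step \<omega> {#a#} = \<omega> a"
  and step_add_mset [simp]: "step \<omega> (add_mset a A) = \<omega> a + step \<omega> A"
  and step_union: "step \<omega> (A + B) = step \<omega> A + step \<omega> B"
  by (simp_all add: step_def)

lemma funpow_step_empty [simp]: "(step \<omega> ^^ n) {#} = {#}"
  by (induction n) simp_all

lemma funpow_step_union: "(step \<omega> ^^ n) (A + B) = (step \<omega> ^^ n) A + (step \<omega> ^^ n) B"
  by (induction n) (simp_all add: step_union)

lemma funpow_step_eq_sum: "(step \<omega> ^^ n) A = (\<Sum>a\<in>#A. (step \<omega> ^^ n) {#a#})"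
proof (induction A)
  case (add a A)
  then show ?case
    using funpow_step_union[of n \<omega> "{#a#}" A] by simp
qed simp

text \<open>\<open>level\<close> recurses at the root, whereas an iterate of \<open>step\<close> can
  also be read as acting on the last level. Additivity of the iterate over the sons reconciles the
  two.\<close>

lemma level_generating_tree: "level n (generating_tree \<omega> a) = (step \<omega> ^^ n) {#a#}"
proof (induction n arbitrary: a)
  case (Suc n)
  have "level (Suc n) (generating_tree \<omega> a) = (\<Sum>s\<in>#\<omega> a. (step \<omega> ^^ n) {#s#})"
    by (simp add: image_mset.compositionality comp_def Suc)
  also have "\<dots> = (step \<omega> ^^ n) (\<omega> a)"
    by (rule funpow_step_eq_sum[symmetric])
  finally show ?case
    by (simp add: funpow_Suc_right del: funpow.simps)
qed simp

lemma production_rule_step: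
  assumes "production_rule \<omega>" and "\<forall>a\<in>#A. a \<ge> 1"
  shows "\<forall>a\<in>#step \<omega> A. a \<ge> 1"
  using assms(2) by (induction A) (use assms(1) in \<open>auto simp: production_rule_def\<close>)

lemma coeff_sum_mset_monom:
  "coeff (\<Sum>e\<in>#A. monom (1 :: 'k::comm_semiring_1) e) i = of_nat (count A i)"
  by (induction A) auto

text \<open>Encoding a multiset as a sum of monomials intertwines \<open>step\<close> with
  \<open>rule_op\<close>; this carries commutation from operators to multisets.\<close>

lemma rule_op_sum_mset_monom:
  "rule_op \<omega> (\<Sum>e\<in>#A. monom (1 :: 'k::field) e) = (\<Sum>e\<in>#step \<omega> A. monom 1 e)"
  by (induction A) (simp_all add: rule_op_def[of \<omega> 0] rule_op_add rule_op_monom)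

lemma step_commute:
  assumes "\<And>p :: 'k::field_char_0 poly. p \<in> xpolys \<Longrightarrow>
      rule_op \<omega> (rule_op \<sigma> p) = rule_op \<sigma> (rule_op \<omega> p)"
    and "\<forall>a\<in>#A. a \<ge> 1"
  shows "step \<omega> (step \<sigma> A) = step \<sigma> (step \<omega> A)"
proof (rule multiset_eqI)
  fix i
  let ?p = "\<lambda>A. \<Sum>e\<in>#A. monom (1 :: 'k) e"
  \<comment> \<open>The constant coefficient counts the label 0, which positivity excludes.\<close>
  have "?p A \<in> xpolys"
    using assms(2) by (auto simp: xpolys_def coeff_sum_mset_monom not_in_iff)
  then have "?p (step \<omega> (step \<sigma> A)) = ?p (step \<sigma> (step \<omega> A))"
    using assms(1) by (metis rule_op_sum_mset_monom)
  then show "count (step \<omega> (step \<sigma> A)) i = count (step \<sigma> (step \<omega> A)) i"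
    by (metis coeff_sum_mset_monom of_nat_eq_iff)
qed

text \<open>Commutation is available only on positive labels, so the induction moves on to
  \<open>step \<sigma> A\<close>, which stays positive because \<open>\<sigma>\<close> is a
  production rule.\<close>

lemma funpow_step_commute:
  assumes "\<And>A. \<forall>a\<in>#A. a \<ge> 1 \<Longrightarrow> step \<omega> (step \<sigma> A) = step \<sigma> (step \<omega> A)"
    and "production_rule \<sigma>" and "\<forall>a\<in>#A. a \<ge> 1"
  shows "(step \<sigma> ^^ k) (step \<omega> A) = step \<omega> ((step \<sigma> ^^ k) A)"
  using assms(3)
proof (induction k arbitrary: A)
  case (Suc k)
  then show ?case
    using assms(1)[of A, symmetric] production_rule_step[OF assms(2), of A]
    by (simp add: funpow_Suc_right del: funpow.simps)
qed simp

lemma sum_diagonal_binomial_Suc_Suc: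
  fixes h :: "nat \<Rightarrow> nat"
  shows "(\<Sum>k\<le>n + 2. (n + 2 - k choose k) * h k) =
    (\<Sum>k\<le>n + 1. (n + 1 - k choose k) * h k) + (\<Sum>k\<le>n. (n - k choose k) * h (Suc k))"
proof -
  have "(\<Sum>k\<le>n + 2. (n + 2 - k choose k) * h k) =
      h 0 + (\<Sum>k\<le>n + 1. (n + 1 - k choose Suc k) * h (Suc k))"
    by (simp add: sum.atMost_Suc_shift del: sum.atMost_Suc)
  \<comment> \<open>The dropped term \<open>k = n + 1\<close> has coefficient
    \<open>0 choose (n + 2) = 0\<close>. Then \<open>k \<le> n\<close> makes
    \<open>n + 1 - k\<close> a successor, as Pascal's rule requires.\<close>
  also have "(\<Sum>k\<le>n + 1. (n + 1 - k choose Suc k) * h (Suc k)) =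
      (\<Sum>k\<le>n. (n + 1 - k choose Suc k) * h (Suc k))"
    by simp
  also have "\<dots> = (\<Sum>k\<le>n. (n - k choose Suc k) * h (Suc k) + (n - k choose k) * h (Suc k))"
    by (intro sum.cong) (auto simp: Suc_diff_le algebra_simps)
  also have "h 0 + \<dots> = (\<Sum>k\<le>n + 1. (n + 1 - k choose k) * h k) +
      (\<Sum>k\<le>n. (n - k choose k) * h (Suc k))"
    by (simp add: sum.atMost_Suc_shift sum.distrib del: sum.atMost_Suc)
  finally show ?thesis .
qed

text \<open>If \<open>2 * k > n\<close> then \<open>n - k < k\<close> and the binomial vanishes. The
  longer range avoids splitting on the parity of \<open>n\<close> in the recurrence.\<close>

lemma sum_diagonal_binomial_restrict:
  fixes h :: "nat \<Rightarrow> nat"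
  shows "(\<Sum>k | 2 * k \<le> n. (n - k choose k) * h k) = (\<Sum>k\<le>n. (n - k choose k) * h k)"
  by (rule sum.mono_neutral_left) (auto intro!: binomial_eq_0)

text \<open>The claim is made for a multiset of roots because removing the roots leaves the forests
  \<open>step \<omega> A\<close> and \<open>step \<sigma> A\<close>, to which the induction
  hypotheses apply.\<close>

lemma sum_mlevel_doubled_mixed_tree:
  assumes comm: "\<And>A. \<forall>a\<in>#A. a \<ge> 1 \<Longrightarrow> step \<omega> (step \<sigma> A) = step \<sigma> (step \<omega> A)"
    and \<omega>: "production_rule \<omega>" and \<sigma>: "production_rule \<sigma>" and "\<forall>a\<in>#A. a \<ge> 1"
  shows "(\<Sum>a\<in>#A. mlevel_size (doubled_mixed_tree \<omega> \<sigma> a) n) =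
    (\<Sum>k | 2 * k \<le> n. (n - k choose k) * size ((step \<omega> ^^ (n - 2 * k)) ((step \<sigma> ^^ k) A)))"
  using assms(4)
proof (induction n arbitrary: A rule: induct_nat_012)
  case 0
  show ?case
    by (simp add: mlevel_size_def)
next
  case 1
  have "{k::nat. 2 * k \<le> Suc 0} = {0}"
    by auto
  moreover have "(\<Sum>a\<in>#A. mlevel_size (doubled_mixed_tree \<omega> \<sigma> a) (Suc 0)) = size (step \<omega> A)"
    by (induction A) (auto simp: mlevel_size_def image_mset.compositionality comp_def)
  ultimately show ?case
    by simp
next
  case (ge2 n)
  let ?F = "\<lambda>n A. \<Sum>a\<in>#A. mlevel_size (doubled_mixed_tree \<omega> \<sigma> a) n"
  \<comment> \<open>Since \<open>n + 2 - 2 * Suc k = n - 2 * k\<close>, one weight serves both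
    forests: at \<open>k\<close> for \<open>\<omega>\<close> and at \<open>Suc k\<close> for
    \<open>\<sigma>\<close>.\<close>
  let ?h = "\<lambda>k. size ((step \<omega> ^^ (n + 2 - 2 * k)) ((step \<sigma> ^^ k) A))"
  have "?F (Suc (Suc n)) A = ?F (Suc n) (step \<omega> A) + ?F n (step \<sigma> A)"
    by (induction A)
      (simp_all add: mlevel_size_def image_mset.compositionality comp_def)
  also have "?F (Suc n) (step \<omega> A) = (\<Sum>k | 2 * k \<le> Suc n. (Suc n - k choose k) *
      size ((step \<omega> ^^ (Suc n - 2 * k)) ((step \<sigma> ^^ k) (step \<omega> A))))"
    using ge2 production_rule_step[OF \<omega>] by blast
  also have "\<dots> = (\<Sum>k | 2 * k \<le> Suc n. (Suc n - k choose k) * ?h k)"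
  proof (intro sum.cong refl)
    fix k assume "k \<in> {k. 2 * k \<le> Suc n}"
    \<comment> \<open>No truncation occurs in this range, so the extra \<open>step \<omega>\<close>,
      moved past the iterates of \<open>step \<sigma>\<close>, raises the exponent by exactly
      one.\<close>
    then have "n + 2 - 2 * k = Suc (Suc n - 2 * k)"
      by auto
    then show "(Suc n - k choose k) *
        size ((step \<omega> ^^ (Suc n - 2 * k)) ((step \<sigma> ^^ k) (step \<omega> A))) =
        (Suc n - k choose k) * ?h k"
      using funpow_step_commute[OF comm \<sigma> ge2.prems]
      by (simp add: funpow_Suc_right del: funpow.simps)
  qed
  also have "?F n (step \<sigma> A) = (\<Sum>k | 2 * k \<le> n. (n - k choose k) *
      size ((step \<omega> ^^ (n - 2 * k)) ((step \<sigma> ^^ k) (step \<sigma> A))))"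
    using ge2 production_rule_step[OF \<sigma>] by blast
  also have "\<dots> = (\<Sum>k | 2 * k \<le> n. (n - k choose k) * ?h (Suc k))"
    by (simp add: funpow_Suc_right del: funpow.simps)
  finally show ?case
    using sum_diagonal_binomial_Suc_Suc[of n ?h]
    by (simp add: sum_diagonal_binomial_restrict del: sum.atMost_Suc)
qed

text \<open>Coefficients of \<open>level_poly\<close> are multiplicities, so the inner sum of the
  formula becomes a sum over nodes.\<close>

lemma sum_coeff_level_poly:
  fixes f :: "nat \<Rightarrow> nat"
  shows "(\<Sum>i\<le>degree (level_poly t n). coeff (level_poly t n) i * f i) = (\<Sum>i\<in>#level n t. f i)"
proof -
  \<comment> \<open>An arbitrary bound \<open>N\<close> replaces the degree, so that it can stay
    fixed while \<open>A\<close> grows in the induction.\<close>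
  have "(\<Sum>i\<le>N. count A i * f i) = (\<Sum>i\<in>#A. f i)" if "\<forall>i\<in>#A. i \<le> N" for A N
    using that
  proof (induction A)
    case (add a A)
    have "(\<Sum>i\<le>N. count (add_mset a A) i * f i) =
        (\<Sum>i\<le>N. (if i = a then f i else 0) + count A i * f i)"
      by (intro sum.cong) auto
    then show ?case
      using add by (simp add: sum.distrib)
  qed simp
  then show ?thesis
    by (simp add: coeff_level_poly le_degree)
qed

theorem theorem4p1:
  fixes \<omega> \<sigma> :: rule and b n :: nat
  assumes "production_rule \<omega>" and "production_rule \<sigma>"
    and "\<And>p :: 'k::field_char_0 poly. p \<in> xpolys \<Longrightarrow>
           rule_op \<omega> (rule_op \<sigma> p) = rule_op \<sigma> (rule_op \<omega> p)"
    and "b \<ge> 1"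
  shows "mlevel_size (doubled_mixed_tree \<omega> \<sigma> b) n =
    (\<Sum>k | 2 * k \<le> n. ((n - k) choose k) *
      (\<Sum>i\<le>degree (level_poly (generating_tree \<sigma> b) k).
         coeff (level_poly (generating_tree \<sigma> b) k) i *
         level_size (generating_tree \<omega> i) (n - 2 * k)))"
proof -
  have size_level: "(\<Sum>i\<in>#A. level_size (generating_tree \<omega> i) m) = size ((step \<omega> ^^ m) A)"
    for m A
    by (simp add: level_size_def level_generating_tree funpow_step_eq_sum[of m \<omega> A]
        image_mset.compositionality comp_def)
  have "(\<Sum>a\<in>#{#b#}. mlevel_size (doubled_mixed_tree \<omega> \<sigma> a) n) =
      (\<Sum>k | 2 * k \<le> n. (n - k choose k) * size ((step \<omega> ^^ (n - 2 * k)) ((step \<sigma> ^^ k) {#b#})))"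
    using assms by (intro sum_mlevel_doubled_mixed_tree step_commute) auto
  then show ?thesis
    by (simp add: sum_coeff_level_poly size_level level_generating_tree)
qed

end
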